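(* Let $G$ be an additive abelian group of unbounded exponent. Then for all positive integers $h$ and $k$, \[ \mathcal{R}_{\mathbb{Z}}(h,k) \subseteq \mathcal{R}_G(h,k) \qquad\text{and}\qquad \widehat{\mathcal{R}}_{\mathbb{Z}}(h,k) \subseteq \widehat{\mathcal{R}}_G(h,k). \]
   Context: An additive abelian group $G$ has bounded exponent if there is a positive integer $m$ with $mx=0$ for all $x\in G$; otherwise it has unbounded exponent. For a nonempty subset $A$ of an additive abelian group $G$ and a positive integer $h$, $hA=\{a_1+\cdots+a_h : a_i\in A\}$ (summands not necessarily distinct) and $\widehat{hA}=\{\sum_{s\in S}s : S\subseteq A,\ |S|=h\}$. For positive integers $h,k$: $\mathcal{R}_G(h,k)=\{|hA| : A\subseteq G,\ |A|=k\}$ and $\widehat{\mathcal{R}}_G(h,k)=\{|\widehat{hA}| : A\subseteq G,\ |A|=k\}$; $\mathcal{R}_{\mathbb{Z}}$, $\widehat{\mathcal{R}}_{\mathbb{Z}}$ denote these sets for the additive group of integers $\mathbb{Z}$. *)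

theory Defs
  imports Main
begin

text \<open>
  An additive abelian group is a type of class \<^class>\<open>ab_group_add\<close>, passed to a constant that
  depends on the whole group as an argument of type \<open>'a itself\<close>.
\<close>

text \<open>The multiple \<open>m x\<close> is the sum of \<open>m\<close> copies of \<open>x\<close>.\<close>

definition bounded_exponent :: "'a::ab_group_add itself \<Rightarrow> bool" where
  "bounded_exponent _ \<longleftrightarrow> (\<exists>m::nat. m > 0 \<and> (\<forall>x::'a. (\<Sum>i<m. x) = 0))"

definition sumset :: "nat \<Rightarrow> 'a::ab_group_add set \<Rightarrow> 'a set" where
  "sumset h A = {\<Sum>i<h. a i | a. \<forall>i<h. a i \<in> A}"

text \<open>For \<open>h > 0\<close>, the condition \<open>card S = h\<close> forces \<open>S\<close> to be finite.\<close>

definition restricted_sumset :: "nat \<Rightarrow> 'a::ab_group_add set \<Rightarrow> 'a set" where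
  "restricted_sumset h A = {\<Sum>s\<in>S. s | S. S \<subseteq> A \<and> card S = h}"

text \<open>For \<open>k > 0\<close>, the condition \<open>card A = k\<close> forces \<open>A\<close> to be finite and nonempty, so
  both kinds of sumset below are finite and \<^const>\<open>card\<close> is their true cardinality.\<close>

definition sumset_sizes :: "'a::ab_group_add itself \<Rightarrow> nat \<Rightarrow> nat \<Rightarrow> nat set" where
  "sumset_sizes _ h k = {card (sumset h A) | A :: 'a set. card A = k}"

definition restricted_sumset_sizes :: "'a::ab_group_add itself \<Rightarrow> nat \<Rightarrow> nat \<Rightarrow> nat set" where
  "restricted_sumset_sizes _ h k = {card (restricted_sumset h A) | A :: 'a set. card A = k}"

end

theory Submission
  imports Defs HOL.Modules
begin

text \<open>
  Unbounded exponent yields, for every finite set \<open>T\<close> of integers, an \<open>x\<close> such that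
  \<open>z \<mapsto> z x\<close> is injective on \<open>T\<close>: let \<open>P\<close> be the product of the positive differences of
  elements of \<open>T\<close> and choose \<open>x\<close> with \<open>P x \<noteq> 0\<close>. Given \<open>A\<close>, take \<open>T\<close> to contain \<open>A\<close> together with
  its two sumsets; the image of \<open>A\<close> under this homomorphism has sumsets of the same sizes.
\<close>

text \<open>Since \<open>nat\<close> truncates at 0, at least one of the two sums is empty, so this
  is the usual multiple \<open>z x\<close> for either sign of \<open>z\<close>.\<close>

definition int_multiple :: "'a::ab_group_add \<Rightarrow> int \<Rightarrow> 'a" where
  "int_multiple x z = (\<Sum>i<nat z. x) - (\<Sum>i<nat (- z). x)"

lemma sum_const_add: "(\<Sum>i<m + n. x) = (\<Sum>i<m. x) + (\<Sum>i<n. x :: 'a::ab_group_add)"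
  for m n :: nat
  by (induction n) (simp_all add: algebra_simps)

lemma sum_const_eq_0_dvd:
  fixes d n :: nat and x :: "'a::ab_group_add"
  assumes "(\<Sum>i<d. x) = 0" and "d dvd n"
  shows "(\<Sum>i<n. x) = 0"
proof -
  obtain q where "n = d * q" using assms(2) by blast
  moreover have "(\<Sum>i<d * q. x) = 0"
    by (induction q) (simp_all add: sum_const_add assms(1))
  ultimately show ?thesis by simp
qed

lemma int_multiple_of_nat: "int_multiple x (int n) = (\<Sum>i<n. x)"
  by (simp add: int_multiple_def)

text \<open>The value can be read off any representation of an integer as a difference of naturals.
  This lets additivity be proved without splitting on signs.\<close>

lemma int_multiple_diff_of_nat:
  "int_multiple x (int m - int n) = (\<Sum>i<m. x) - (\<Sum>i<n. x)"
proof -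
  \<comment> \<open>Both sides equal the maximum of \<open>m\<close> and \<open>n\<close>; this is
    the claim with its subtractions moved across.\<close>
  have "m + nat (int n - int m) = nat (int m - int n) + n" by linarith
  then have "(\<Sum>i<m + nat (int n - int m). x) = (\<Sum>i<nat (int m - int n) + n. x)" by simp
  then show ?thesis
    unfolding sum_const_add int_multiple_def by (simp add: algebra_simps)
qed

lemma additive_int_multiple: "additive (int_multiple x)"
proof
  fix z w :: int
  obtain a b c d where zw: "z = int a - int b" "w = int c - int d"
    by (metis int_diff_cases)
  have "z + w = int (a + c) - int (b + d)" by (simp add: zw)
  then show "int_multiple x (z + w) = int_multiple x z + int_multiple x w"
    by (simp only: zw int_multiple_diff_of_nat sum_const_add) (simp add: algebra_simps)
qed

lemma ex_inj_on_int_multiple: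
  fixes T :: "int set"
  assumes "\<not> bounded_exponent TYPE('a::ab_group_add)" and "finite T"
  obtains x :: "'a::ab_group_add" where "inj_on (int_multiple x) T"
proof -
  \<comment> \<open>\<open>nat\<close> sends every nonpositive difference to 0, and
    \<open>0 < n\<close> discards it, so the product of \<open>D\<close> is positive.\<close>
  define D where "D = {n. 0 < n \<and> n \<in> (\<lambda>(z, w). nat (z - w)) ` (T \<times> T)}"
  have "finite D" unfolding D_def using assms(2) by simp
  have "0 < \<Prod>D" by (rule prod_pos) (simp add: D_def)
  then obtain x :: 'a where x: "(\<Sum>i<\<Prod>D. x) \<noteq> 0"
    using assms(1) unfolding bounded_exponent_def by blast
  \<comment> \<open>A collision makes some \<open>d\<close> in \<open>D\<close> annihilate
    \<open>x\<close>. As \<open>d\<close> divides \<open>\<Prod>D\<close>, the product would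
    annihilate \<open>x\<close> too, against its choice.\<close>
  have neq: "int_multiple x z \<noteq> int_multiple x w" if "z \<in> T" "w \<in> T" "w < z" for z w
  proof
    assume "int_multiple x z = int_multiple x w"
    then have "int_multiple x (z - w) = 0"
      by (simp add: additive.diff[OF additive_int_multiple])
    then have "(\<Sum>i<nat (z - w). x) = 0"
      using that(3) int_multiple_of_nat[of x "nat (z - w)"] by simp
    moreover have "nat (z - w) \<in> (\<lambda>(z, w). nat (z - w)) ` (T \<times> T)"
      using that by (intro image_eqI[of _ _ "(z, w)"]) simp_all
    then have "nat (z - w) \<in> D" unfolding D_def using that(3) by simp
    then have "nat (z - w) dvd \<Prod>D" using dvd_prodI[OF \<open>finite D\<close>, of _ "\<lambda>n. n"] by blast
    ultimately show False using x sum_const_eq_0_dvd by blast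
  qed
  have "inj_on (int_multiple x) T"
    by (rule linorder_inj_onI') (use neq in force)+
  then show thesis by (rule that)
qed

lemma sumset_image:
  assumes "additive f"
  shows "sumset h (f ` A) = f ` sumset h A"
proof (intro set_eqI iffI)
  fix y assume "y \<in> sumset h (f ` A)"
  then obtain b where y: "y = (\<Sum>i<h. b i)" and "\<forall>i<h. b i \<in> f ` A"
    unfolding sumset_def by blast
  then have "\<forall>i<h. \<exists>a. a \<in> A \<and> b i = f a" by blast
  \<comment> \<open>Preimages are chosen index by index, so repeated summands cause no
    trouble.\<close>
  then obtain a where a: "\<forall>i<h. a i \<in> A \<and> b i = f (a i)" by metis
  then have "y = f (\<Sum>i<h. a i)" by (simp add: y additive.sum[OF assms])
  then show "y \<in> f ` sumset h A" unfolding sumset_def using a by blast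
next
  fix y assume "y \<in> f ` sumset h A"
  then obtain a where "y = f (\<Sum>i<h. a i)" and a: "\<forall>i<h. a i \<in> A"
    unfolding sumset_def by blast
  then have "y = (\<Sum>i<h. f (a i))" by (simp add: additive.sum[OF assms])
  moreover have "\<forall>i<h. f (a i) \<in> f ` A" using a by blast
  ultimately have "\<exists>b. y = (\<Sum>i<h. b i) \<and> (\<forall>i<h. b i \<in> f ` A)"
    by (intro exI[of _ "\<lambda>i. f (a i)"] conjI)
  then show "y \<in> sumset h (f ` A)" unfolding sumset_def by (rule CollectI)
qed

text \<open>Injectivity on \<open>A\<close> keeps distinct summands distinct, so the
  \<open>h\<close>-element subsets of the image are exactly the images of the
  \<open>h\<close>-element subsets of \<open>A\<close>.\<close>

lemma restricted_sumset_image: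
  assumes "additive f" and inj: "inj_on f A"
  shows "restricted_sumset h (f ` A) = f ` restricted_sumset h A"
proof -
  have sum: "(\<Sum>s\<in>f ` S. s) = f (\<Sum>s\<in>S. s)" and card: "card (f ` S) = card S" if "S \<subseteq> A" for S
    using inj_on_subset[OF inj that]
    by (simp_all add: sum.reindex additive.sum[OF assms(1)] card_image)
  show ?thesis
  proof (intro set_eqI iffI)
    fix y assume "y \<in> restricted_sumset h (f ` A)"
    then obtain S where "S \<subseteq> A" "card (f ` S) = h" "y = (\<Sum>s\<in>f ` S. s)"
      unfolding restricted_sumset_def by (auto simp: subset_image_iff)
    then show "y \<in> f ` restricted_sumset h A"
      unfolding restricted_sumset_def using sum card by auto
  next
    fix y assume "y \<in> f ` restricted_sumset h A"
    then obtain S where S: "S \<subseteq> A" "card S = h" "y = f (\<Sum>s\<in>S. s)"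
      unfolding restricted_sumset_def by blast
    then have "f ` S \<subseteq> f ` A" "card (f ` S) = h" "y = (\<Sum>s\<in>f ` S. s)"
      using sum card by auto
    then show "y \<in> restricted_sumset h (f ` A)"
      unfolding restricted_sumset_def by blast
  qed
qed

text \<open>Splitting off the last summand bounds each sumset by the image of a finite
  product.\<close>

lemma finite_sumset:
  assumes "finite A"
  shows "finite (sumset h A)"
proof (induction h)
  case 0
  then show ?case by (simp add: sumset_def)
next
  case (Suc h)
  have "sumset (Suc h) A \<subseteq> (\<lambda>(s, a). s + a) ` (sumset h A \<times> A)"
    unfolding sumset_def by force
  then show ?case using Suc assms by (meson finite_SigmaI finite_imageI finite_subset)
qed

lemma finite_restricted_sumset:
  assumes "finite A"
  shows "finite (restricted_sumset h A)"
proof -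
  have "restricted_sumset h A \<subseteq> (\<lambda>S. \<Sum>s\<in>S. s) ` Pow A"
    unfolding restricted_sumset_def by blast
  then show ?thesis using assms by (meson finite_Pow_iff finite_imageI finite_subset)
qed

lemma ex_same_sumset_sizes:
  fixes A :: "int set"
  assumes "\<not> bounded_exponent TYPE('a::ab_group_add)" and "finite A"
  obtains B :: "'a::ab_group_add set" where "card B = card A" "card (sumset h B) = card (sumset h A)"
    "card (restricted_sumset h B) = card (restricted_sumset h A)"
proof -
  have "finite (A \<union> sumset h A \<union> restricted_sumset h A)"
    using assms(2) by (simp add: finite_sumset finite_restricted_sumset)
  then obtain x :: 'a where
    "inj_on (int_multiple x) (A \<union> sumset h A \<union> restricted_sumset h A)"
    by (rule ex_inj_on_int_multiple[OF assms(1)])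
  \<comment> \<open>Injectivity on \<open>A\<close> preserves its size and the distinctness of
    summands; on the two sumsets it preserves their sizes.\<close>
  then have "inj_on (int_multiple x) A" "inj_on (int_multiple x) (sumset h A)"
    "inj_on (int_multiple x) (restricted_sumset h A)"
    by (simp_all add: inj_on_Un)
  then show thesis
    by (intro that[of "int_multiple x ` A"])
      (simp_all add: card_image sumset_image restricted_sumset_image additive_int_multiple)
qed

theorem theorem3:
  fixes h k :: nat
  assumes "\<not> bounded_exponent TYPE('a::ab_group_add)"
    and "h > 0" and "k > 0"
  shows "sumset_sizes TYPE(int) h k \<subseteq> sumset_sizes TYPE('a) h k \<and>
    restricted_sumset_sizes TYPE(int) h k \<subseteq> restricted_sumset_sizes TYPE('a) h k"
proof -
  have "\<exists>B :: 'a set. card B = k \<and> card (sumset h B) = card (sumset h A) \<and>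
      card (restricted_sumset h B) = card (restricted_sumset h A)"
    if "card A = k" for A :: "int set"
  proof -
    \<comment> \<open>An infinite set has \<open>card\<close> 0, which \<open>k > 0\<close>
      excludes.\<close>
    have "finite A" using that \<open>k > 0\<close> by (simp add: card_ge_0_finite)
    then show ?thesis using ex_same_sumset_sizes[OF assms(1)] that by metis
  qed
  then show ?thesis
    unfolding sumset_sizes_def restricted_sumset_sizes_def
    by (intro conjI subsetI; clarsimp) metis+
qed

end
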